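(* Let $m\ge1$, $n^{(1)},\dots,n^{(m)}\in\mathbb R^D$, $q^{(1)},\dots,q^{(m)}\in\mathbb R$, $\mathcal Q(x)=\prod_{i=1}^m(n^{(i)}\cdot x-q^{(i)})$, and $k\ge0$. Suppose that $\bigcup_{i=1}^m\{p^{(i)}_j\}_{j=1}^{|[k-1+i]|}\subset\bigcup_{i=1}^m\pi^{(i),+}$, where $\pi^{(i),+}=\{x\in\mathbb R^D:n^{(i)}\cdot x=q^{(i)}\}$, is a poised set, i.e. $$\begin{vmatrix}\Sigma^{(1),k}_{[k]}&\dots&\Sigma^{(m),k+m-1}_{[k]}\\ \vdots&&\vdots\\ \Sigma^{(1),k}_{[k+m-1]}&\dots&\Sigma^{(m),k+m-1}_{[k+m-1]}\end{vmatrix}\neq0.$$ Then the following multivariate quasi-determinantal Christoffel formulas hold for the orthogonal polynomials $TP$ and second kind functions $TC$ of the measure $\mathcal Q(x)\,d\mu(x)$: $$TP_{[k]}(x)=\frac{\big(\prod_{i=1}^m(n^{(i)}\cdot\Lambda)\big)_{[k],[k+m]}}{\mathcal Q(x)}\,\Theta_*\begin{pmatrix}\Sigma^{(1),k}_{[k]}&\dots&\Sigma^{(m),k+m-1}_{[k]}&P_{[k]}(x)\\ \vdots&&\vdots&\vdots\\ \Sigma^{(1),k}_{[k+m]}&\dots&\Sigma^{(m),k+m-1}_{[k+m]}&P_{[k+m]}(x)\end{pmatrix},$$ $$TC_{[k]}(x)=\Big(\prod_{i=1}^m(n^{(i)}\cdot\Lambda)\Big)_{[k],[k+m]}\,\Theta_*\begin{pmatrix}\Sigma^{(1),k}_{[k]}&\dots&\Sigma^{(m),k+m-1}_{[k]}&C_{[k]}(x)\\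 \vdots&&\vdots&\vdots\\ \Sigma^{(1),k}_{[k+m]}&\dots&\Sigma^{(m),k+m-1}_{[k+m]}&C_{[k+m]}(x)\end{pmatrix}.$$
   Context: Let $D\ge 1$ and let $\mu$ be a Borel measure on $\Omega\subseteq\mathbb R^D$ with finite moments. For $k\in\mathbb Z_+$ let $[k]=\{\alpha\in\mathbb Z_+^D:|\alpha|=k\}$, ordered so that $\alpha>\alpha'$ iff at the first coordinate where they differ the entry of $\alpha$ is smaller. $\chi_{[k]}(x)$ is the column vector of monomials $x^\alpha$, $\alpha\in[k]$, and $\chi$ stacks $\chi_{[0]},\chi_{[1]},\dots$; $\chi^*(x)=\big(\prod_ax_a^{-1}\big)\chi(x_1^{-1},\dots,x_D^{-1})$. Semi-infinite matrices are partitioned in blocks $A_{[k],[\ell]}\in\mathbb R^{|[k]|\times|[\ell]|}$. For a measure whose moment matrix $G=\int\chi\,d\mu\,\chi^\top$ has a block Cholesky factorization $G=S^{-1}H(S^{-1})^\top$ ($S$ block lower triangular with identity diagonal blocks, $H$ block diagonal with invertible blocks), its orthogonal polynomials are $P=S\chi$ and its second kind functions are $C=H(S^{-1})^\top\chi^*$ (Laurent series), with blocks $P_{[k]}$, $C_{[k]}$. $T=T^{(1)}\cdots T^{(m)}$ is the composition of the elementary Darboux transformations $T^{(i)}:d\mu(x)\mapsto(n^{(i)}\cdot x-q^{(i)})d\mu(x)$; all measures involved are assumed to have block Cholesky factorizable moment matrices, and $TP$, $TC$ are the orthogonal polynomials and second kind functions of $T\,d\mu=\mathcal Q\,d\mu$,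 while $P$, $C$ are those of $d\mu$. Shift matrices: $\Lambda_a$ has as only nonzero blocks $(\Lambda_a)_{[k],[k+1]}$, with entries $\delta_{\alpha+e_a,\alpha'}$, $\alpha\in[k]$, $\alpha'\in[k+1]$; $n\cdot\Lambda=\sum_an_a\Lambda_a$. Sample matrices: for the $i$-th set of nodes $\{p^{(i)}_j\}_{j=1}^{|[k+i-1]|}$, $\Sigma^{(i),k+i-1}_{[\ell]}=\big(P_{[\ell]}(p^{(i)}_1)\ \cdots\ P_{[\ell]}(p^{(i)}_{|[k+i-1]|})\big)\in\mathbb R^{|[\ell]|\times|[k+i-1]|}$. Quasi-determinant: $\Theta_*\begin{pmatrix}A&B\\C&E\end{pmatrix}=E-CA^{-1}B$, where $E$ is the lower right corner block and the invertible square matrix $A$ consists of all block rows and columns except the last ones. *)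

theory Defs
  imports
    "HOL-Analysis.Analysis"
    "HOL-Library.Groups_Big_Fun"
    "HOL-Library.Fun_Lexorder"
    "Jordan_Normal_Form.Determinant"
    "Jordan_Normal_Form.Gauss_Jordan_Elimination"
begin

text \<open>
  The ambient space is \<^typ>\<open>real^'d\<close>; the coordinates are ordered, so \<^typ>\<open>'d\<close> is both
  \<^class>\<open>finite\<close> and \<^class>\<open>linorder\<close> wherever the order of the monomials matters.
  Coordinates are accessed by \<^const>\<open>vec_nth\<close>, since both parent libraries use the
  infix dollar sign.
\<close>

type_synonym 'd point = "real^'d"

type_synonym 'd multiindex = "'d \<Rightarrow> nat"

definition mdeg :: "'d::finite multiindex \<Rightarrow> nat" where
  "mdeg \<alpha> = (\<Sum>a\<in>UNIV. \<alpha> a)"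

definition deg_set :: "nat \<Rightarrow> 'd::finite multiindex set" where
  "deg_set k = {\<alpha>. mdeg \<alpha> = k}"

text \<open>
  The increasing enumeration of \<^term>\<open>deg_set k\<close>. A multi-index is larger if it has the smaller
  entry at the first coordinate of difference: \<open>\<beta> > \<alpha>\<close> in this order is
  \<^term>\<open>less_fun \<beta> \<alpha>\<close>.
\<close>

definition deg_list :: "nat \<Rightarrow> 'd::{finite,linorder} multiindex list" where
  "deg_list k = (THE \<alpha>s. sorted_wrt (\<lambda>\<alpha> \<beta>. less_fun \<beta> \<alpha>) \<alpha>s \<and> set \<alpha>s = deg_set k)"

definition mv_monom :: "'d::finite multiindex \<Rightarrow> 'd point \<Rightarrow> real" where
  "mv_monom \<alpha> x = (\<Prod>a\<in>UNIV. vec_nth x a ^ \<alpha> a)"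


text \<open>
  Darboux transformations do not preserve positivity, so a Borel measure is given as a pair
  \<open>(M, w)\<close> standing for the real measure \<open>w dM\<close>; a positive measure \<open>M\<close> is \<open>(M, \<lambda>x. 1)\<close>.
\<close>

type_synonym 'd rmeasure = "('d point) measure \<times> ('d point \<Rightarrow> real)"

definition borel_on :: "'d::finite point set \<Rightarrow> 'd rmeasure \<Rightarrow> bool" where
  "borel_on \<Omega> \<mu> \<longleftrightarrow>
     sets (fst \<mu>) = sets (restrict_space borel \<Omega>) \<and> snd \<mu> \<in> borel_measurable (fst \<mu>)"

definition finite_moments :: "'d::finite rmeasure \<Rightarrow> bool" where
  "finite_moments \<mu> \<longleftrightarrow> (\<forall>\<alpha>. integrable (fst \<mu>) (\<lambda>x. mv_monom \<alpha> x * snd \<mu> x))"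

definition darboux :: "'d::finite point \<Rightarrow> real \<Rightarrow> 'd rmeasure \<Rightarrow> 'd rmeasure" where
  "darboux n q \<mu> = (fst \<mu>, \<lambda>x. (inner n x - q) * snd \<mu> x)"

text \<open>Indices of the elementary transformations and of the nodes start from \<open>0\<close>.\<close>

definition darboux_comp ::
  "nat \<Rightarrow> (nat \<Rightarrow> 'd::finite point) \<Rightarrow> (nat \<Rightarrow> real) \<Rightarrow> 'd rmeasure \<Rightarrow> 'd rmeasure" where
  "darboux_comp m n q = foldr (\<lambda>i. darboux (n i) (q i)) [0..<m]"


text \<open>
  Semi-infinite matrices, with entries indexed by multi-indices. \<^const>\<open>Sum_any\<close> is a finite
  sum over the support of the summand, and \<open>0\<close> if that support is infinite. The latter never
  happens in the products formed here: the left factors have finitely supported rows, or the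
  vector is \<^term>\<open>chi_star\<close> below, read coefficientwise.
\<close>

type_synonym 'd smat = "'d multiindex \<Rightarrow> 'd multiindex \<Rightarrow> real"

definition smat_one :: "'d smat" where
  "smat_one \<alpha> \<beta> = (if \<alpha> = \<beta> then 1 else 0)"

definition smat_mult :: "'d smat \<Rightarrow> 'd smat \<Rightarrow> 'd smat" where
  "smat_mult A B \<alpha> \<beta> = Sum_any (\<lambda>\<gamma>. A \<alpha> \<gamma> * B \<gamma> \<beta>)"

definition smat_vec :: "'d smat \<Rightarrow> ('d multiindex \<Rightarrow> real) \<Rightarrow> 'd multiindex \<Rightarrow> real" where
  "smat_vec A v \<alpha> = Sum_any (\<lambda>\<gamma>. A \<alpha> \<gamma> * v \<gamma>)"

definition smat_transpose :: "'d smat \<Rightarrow> 'd smat" where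
  "smat_transpose A \<alpha> \<beta> = A \<beta> \<alpha>"

definition block :: "'d::{finite,linorder} smat \<Rightarrow> nat \<Rightarrow> nat \<Rightarrow> real mat" where
  "block A k l = mat (card (deg_set k :: 'd multiindex set)) (card (deg_set l :: 'd multiindex set))
     (\<lambda>(r, c). A (deg_list k ! r) (deg_list l ! c))"

definition block_lower_unitri :: "'d::{finite,linorder} smat \<Rightarrow> bool" where
  "block_lower_unitri S \<longleftrightarrow>
     (\<forall>k. block S k k = 1\<^sub>m (card (deg_set k :: 'd multiindex set))) \<and>
     (\<forall>k l. k < l \<longrightarrow>
        block S k l = 0\<^sub>m (card (deg_set k :: 'd multiindex set)) (card (deg_set l :: 'd multiindex set)))"

definition block_diag_invertible :: "'d::{finite,linorder} smat \<Rightarrow> bool" where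
  "block_diag_invertible H \<longleftrightarrow>
     (\<forall>k. invertible_mat (block H k k)) \<and>
     (\<forall>k l. k \<noteq> l \<longrightarrow>
        block H k l = 0\<^sub>m (card (deg_set k :: 'd multiindex set)) (card (deg_set l :: 'd multiindex set)))"

text \<open>
  A semi-infinite matrix may have several inverses; the inverse of a block lower unitriangular
  matrix is the one in the group of such matrices.
\<close>

definition smat_inv :: "'d::{finite,linorder} smat \<Rightarrow> 'd smat" where
  "smat_inv S =
     (THE R. block_lower_unitri R \<and> smat_mult S R = smat_one \<and> smat_mult R S = smat_one)"

definition moment_matrix :: "'d::finite rmeasure \<Rightarrow> 'd smat" where
  "moment_matrix \<mu> \<alpha> \<beta> = (LINT x|fst \<mu>. mv_monom \<alpha> x * mv_monom \<beta> x * snd \<mu> x)"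

definition block_cholesky ::
  "'d::{finite,linorder} smat \<Rightarrow> 'd smat \<Rightarrow> 'd smat \<Rightarrow> bool" where
  "block_cholesky G S H \<longleftrightarrow>
     block_lower_unitri S \<and> block_diag_invertible H \<and>
     G = smat_mult (smat_mult (smat_inv S) H) (smat_transpose (smat_inv S))"


definition orth_poly :: "'d::finite smat \<Rightarrow> 'd multiindex \<Rightarrow> 'd point \<Rightarrow> real" where
  "orth_poly S \<alpha> x = smat_vec S (\<lambda>\<beta>. mv_monom \<beta> x) \<alpha>"

text \<open>
  A formal Laurent series in \<open>x\<^sub>1, \<dots>, x\<^sub>D\<close> is its family of coefficients: \<open>F \<xi>\<close> is the coefficient
  of the monomial with the integer exponents \<open>\<xi>\<close>. The entry of \<open>\<chi>\<^sup>*\<close> at the multi-index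
  \<open>\<alpha>\<close> is the single monomial with exponents \<open>- \<alpha> - (1, \<dots>, 1)\<close>.
\<close>

type_synonym 'd laurent = "('d \<Rightarrow> int) \<Rightarrow> real"

definition chi_star :: "'d multiindex \<Rightarrow> 'd laurent" where
  "chi_star \<alpha> \<xi> = (if \<xi> = (\<lambda>a. - int (\<alpha> a) - 1) then 1 else 0)"

definition second_kind ::
  "'d::{finite,linorder} smat \<Rightarrow> 'd smat \<Rightarrow> 'd multiindex \<Rightarrow> 'd laurent" where
  "second_kind S H \<alpha> \<xi> =
     smat_vec (smat_mult H (smat_transpose (smat_inv S))) (\<lambda>\<gamma>. chi_star \<gamma> \<xi>) \<alpha>"

text \<open>
  The block with index \<open>k\<close> of a semi-infinite vector \<open>F\<close> as a one-column matrix. For the orthogonal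
  polynomials \<open>z\<close> is a point; for the second kind functions \<open>z\<close> is an exponent, and the column
  consists of the coefficients of that monomial.
\<close>

definition col_block ::
  "('d::{finite,linorder} multiindex \<Rightarrow> 'z \<Rightarrow> real) \<Rightarrow> nat \<Rightarrow> 'z \<Rightarrow> real mat" where
  "col_block F k z = mat (card (deg_set k :: 'd multiindex set)) 1 (\<lambda>(r, c). F (deg_list k ! r) z)"


definition shift_matrix :: "'d \<Rightarrow> 'd smat" where
  "shift_matrix a \<alpha> \<beta> = (if \<beta> = \<alpha>(a := \<alpha> a + 1) then 1 else 0)"

definition shift_dot :: "'d::finite point \<Rightarrow> 'd smat" where
  "shift_dot n \<alpha> \<beta> = (\<Sum>a\<in>UNIV. vec_nth n a * shift_matrix a \<alpha> \<beta>)"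

definition shift_prod :: "nat \<Rightarrow> (nat \<Rightarrow> 'd::finite point) \<Rightarrow> 'd smat" where
  "shift_prod m n = foldr (\<lambda>i. smat_mult (shift_dot (n i))) [0..<m] smat_one"

text \<open>The sample matrix with rows in \<open>deg_set l\<close> for the \<open>N\<close> nodes \<open>p 0, \<dots>, p (N - 1)\<close>.\<close>

definition sample_matrix ::
  "('d::{finite,linorder} multiindex \<Rightarrow> 'd point \<Rightarrow> real) \<Rightarrow> nat \<Rightarrow> (nat \<Rightarrow> 'd point) \<Rightarrow> nat \<Rightarrow> real mat"
  where
  "sample_matrix P N p l =
     mat (card (deg_set l :: 'd multiindex set)) N (\<lambda>(r, j). P (deg_list l ! r) (p j))"


text \<open>Nonempty matrices of blocks, given as the list of their block rows.\<close>

definition hstack :: "'a mat list \<Rightarrow> 'a mat" where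
  "hstack As = mat_of_cols (dim_row (hd As)) (concat (map cols As))"

definition vstack :: "'a mat list \<Rightarrow> 'a mat" where
  "vstack As = mat_of_rows (dim_col (hd As)) (concat (map rows As))"

definition block_mat :: "'a mat list list \<Rightarrow> 'a mat" where
  "block_mat Bs = vstack (map hstack Bs)"

definition quasi_det :: "'a::field mat list list \<Rightarrow> 'a mat" where
  "quasi_det Bs =
     (let A = block_mat (map butlast (butlast Bs));
          B = block_mat (map (\<lambda>r. [last r]) (butlast Bs));
          C = block_mat [butlast (last Bs)];
          E = last (last Bs)
      in E - C * the (mat_inverse A) * B)"

end

theory Submission
  imports Defs
begin

text \<open>
  Multiplying the measure by \<open>Q\<close> multiplies the moment matrix \<open>G\<close> from the left by \<open>Q(\<Lambda>)\<close>, and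
  \<open>Q(\<Lambda>) \<chi> = Q \<chi>\<close>. Let \<open>\<omega> = TS Q(\<Lambda>) S\<^sup>-\<^sup>1\<close>. Then \<open>\<omega> P = Q TP\<close>, and comparing the two factorizations
  gives \<open>\<omega> H S\<^sup>-\<^sup>T = TH TS\<^sup>-\<^sup>T\<close>, so that \<open>\<omega> C = TC\<close> and \<open>\<omega>\<close> is block upper triangular. As \<open>\<omega>\<close> also has
  only \<open>m\<close> block superdiagonals, its block row \<open>k\<close> lives in the columns \<open>k, \<dots>, k + m\<close>, and its last
  block is the one of \<open>\<Prod> n\<^sub>i \<cdot> \<Lambda>\<close>. Since \<open>Q\<close> vanishes at the nodes, poisedness determines the other
  blocks, and eliminating them produces the quasi-determinant.
\<close>

section \<open>Block matrices indexed by lists\<close>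

lemma finite_mdeg_le: "finite {\<alpha>::'d::finite multiindex. mdeg \<alpha> \<le> n}"
proof -
  have "\<alpha> a \<le> n" if "mdeg \<alpha> \<le> n" for \<alpha> :: "'d multiindex" and a
    using that member_le_sum[of a UNIV \<alpha>] by (simp add: mdeg_def)
  then have "{\<alpha>::'d multiindex. mdeg \<alpha> \<le> n} \<subseteq> (\<Pi>\<^sub>E a\<in>UNIV. {..n})"
    by (auto simp: PiE_UNIV_domain)
  then show ?thesis
    by (rule finite_subset) (auto intro: finite_PiE)
qed

lemma finite_deg_set [simp]: "finite (deg_set k :: 'd::finite multiindex set)"
  by (rule finite_subset[OF _ finite_mdeg_le[of k]]) (auto simp: deg_set_def)

text \<open>Multi-indices grow as \<open>less_fun\<close> decreases. As a linear order, the reversed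
  relation gives access to the facts on strictly sorted lists that justify the definite description
  in \<open>deg_list\<close>.\<close>

lemma linorder_greater_fun:
  "class.linorder (\<lambda>(f::'d::{finite,linorder} \<Rightarrow> nat) g. less_fun g f \<or> f = g) (\<lambda>f g. less_fun g f)"
proof
  fix f g h :: "'d \<Rightarrow> nat"
  show "less_fun g f \<longleftrightarrow> (less_fun g f \<or> f = g) \<and> \<not> (less_fun f g \<or> g = f)"
    using less_fun_asym[of f g] less_fun_asym[of g f] by (auto simp: less_fun_irrefl)
  show "less_fun h f \<or> f = h" if "less_fun g f \<or> f = g" "less_fun h g \<or> g = h"
    using that less_fun_trans[of h g f] by auto
  show "f = g" if "less_fun g f \<or> f = g" "less_fun f g \<or> g = f"
    using that less_fun_asym[of f g] by auto
  show "(less_fun g f \<or> f = g) \<or> (less_fun f g \<or> g = f)"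
    using less_fun_trichotomy[of f g] by auto
qed auto

lemma
  fixes k :: nat
  shows set_deg_list [simp]: "set (deg_list k :: 'd::{finite,linorder} multiindex list) = deg_set k"
    and distinct_deg_list [simp]: "distinct (deg_list k :: 'd multiindex list)"
    and length_deg_list [simp]: "length (deg_list k :: 'd multiindex list) = card (deg_set k :: 'd multiindex set)"
proof -
  let ?P = "\<lambda>\<alpha>s :: 'd multiindex list. sorted_wrt (\<lambda>\<alpha> \<beta>. less_fun \<beta> \<alpha>) \<alpha>s \<and> set \<alpha>s = deg_set k"
  obtain \<alpha>s where ex: "?P \<alpha>s"
    using linorder.finite_set_strict_sorted[OF linorder_greater_fun finite_deg_set] by metis
  have "\<exists>!\<alpha>s. ?P \<alpha>s"
  proof (rule ex1I[of ?P, OF ex])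
    show "\<beta>s = \<alpha>s" if "?P \<beta>s" for \<beta>s
      using linorder.strict_sorted_equal[OF linorder_greater_fun] ex that by (metis (no_types))
  qed
  then have "?P (deg_list k)"
    unfolding deg_list_def by (rule theI')
  then have s: "set (deg_list k :: 'd multiindex list) = deg_set k"
    and w: "sorted_wrt (\<lambda>\<alpha> \<beta>. less_fun \<beta> \<alpha>) (deg_list k :: 'd multiindex list)"
    by blast+
  then show "set (deg_list k :: 'd multiindex list) = deg_set k" by blast
  show d: "distinct (deg_list k :: 'd multiindex list)"
    using linorder.strict_sorted_iff[OF linorder_greater_fun, of "deg_list k"] w by blast
  show "length (deg_list k :: 'd multiindex list) = card (deg_set k :: 'd multiindex set)"
    using distinct_card[OF d] s by simp
qed

lemma mem_deg_set [simp]: "\<alpha> \<in> deg_set k \<longleftrightarrow> mdeg \<alpha> = k"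
  by (simp add: deg_set_def)

text \<open>Labels may be multi-indices, nodes or a single evaluation argument. Blocks, sample
  matrices and column blocks become instances of one notion, and stacking turns into concatenation
  of label lists.\<close>

definition list_mat :: "('a \<Rightarrow> 'b \<Rightarrow> 'c) \<Rightarrow> 'a list \<Rightarrow> 'b list \<Rightarrow> 'c mat" where
  "list_mat f xs ys = mat (length xs) (length ys) (\<lambda>(r, c). f (xs ! r) (ys ! c))"

lemma list_mat_dim [simp]:
  "dim_row (list_mat f xs ys) = length xs" "dim_col (list_mat f xs ys) = length ys"
  by (simp_all add: list_mat_def)

lemma list_mat_index [simp]:
  "r < length xs \<Longrightarrow> c < length ys \<Longrightarrow> list_mat f xs ys $$ (r, c) = f (xs ! r) (ys ! c)"
  by (simp add: list_mat_def)

lemma list_mat_carrier [simp]: "list_mat f xs ys \<in> carrier_mat (length xs) (length ys)"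
  by (rule carrier_matI) simp_all

lemma list_mat_eq_iff:
  "list_mat f xs ys = list_mat g xs ys \<longleftrightarrow> (\<forall>x\<in>set xs. \<forall>y\<in>set ys. f x y = g x y)"
  unfolding mat_eq_iff by (simp add: all_set_conv_all_nth)

lemma list_mat_mult:
  "list_mat f xs ys * list_mat g ys zs = list_mat (\<lambda>x z. \<Sum>y\<leftarrow>ys. f x y * g y z) xs zs"
proof (rule eq_matI)
  fix i j assume "i < dim_row (list_mat (\<lambda>x z. \<Sum>y\<leftarrow>ys. f x y * g y z) xs zs)"
    "j < dim_col (list_mat (\<lambda>x z. \<Sum>y\<leftarrow>ys. f x y * g y z) xs zs)"
  then show "(list_mat f xs ys * list_mat g ys zs) $$ (i, j)
      = list_mat (\<lambda>x z. \<Sum>y\<leftarrow>ys. f x y * g y z) xs zs $$ (i, j)"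
    by (simp add: scalar_prod_def sum_list_sum_nth)
qed simp_all

lemma list_mat_mult_distinct:
  assumes "distinct ys"
  shows "list_mat f xs ys * list_mat g ys zs = list_mat (\<lambda>x z. \<Sum>y\<in>set ys. f x y * g y z) xs zs"
  by (simp only: list_mat_mult sum_list_distinct_conv_sum_set[OF assms])

lemma hstack_list_mat:
  assumes "iss \<noteq> []"
  shows "hstack (map (\<lambda>i. list_mat f xs (ys i)) iss) = list_mat f xs (concat (map ys iss))"
proof -
  have "concat (map cols (map (\<lambda>i. list_mat f xs (ys i)) iss))
      = map (\<lambda>y. vec (length xs) (\<lambda>r. f (xs ! r) y)) (concat (map ys iss))"
    by (auto simp: cols_def col_def map_concat comp_def intro!: arg_cong[of _ _ concat]
        nth_equalityI)
  then show ?thesis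
    using assms by (auto simp: hstack_def hd_map mat_of_cols_def intro!: eq_matI)
qed

lemma vstack_list_mat:
  assumes "iss \<noteq> []"
  shows "vstack (map (\<lambda>i. list_mat f (xs i) ys) iss) = list_mat f (concat (map xs iss)) ys"
proof -
  have "concat (map rows (map (\<lambda>i. list_mat f (xs i) ys) iss))
      = map (\<lambda>x. vec (length ys) (\<lambda>c. f x (ys ! c))) (concat (map xs iss))"
    by (auto simp: rows_def row_def map_concat comp_def intro!: arg_cong[of _ _ concat]
        nth_equalityI)
  then show ?thesis
    using assms by (auto simp: vstack_def hd_map mat_of_rows_def intro!: eq_matI)
qed

lemma block_mat_list_mat:
  assumes "ls \<noteq> []" "js \<noteq> []"
  shows "block_mat (map (\<lambda>l. map (\<lambda>i. list_mat f (xs l) (ys i)) js) ls) =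
    list_mat f (concat (map xs ls)) (concat (map ys js))"
  using assms by (simp add: block_mat_def comp_def hstack_list_mat vstack_list_mat)

lemma block_list_mat: "block A k l = list_mat A (deg_list k) (deg_list l)"
  by (simp add: block_def list_mat_def)

lemma sample_matrix_list_mat:
  "sample_matrix P N p l = list_mat (\<lambda>\<alpha> x. P \<alpha> x) (deg_list l) (map p [0..<N])"
  by (auto simp: sample_matrix_def list_mat_def intro!: eq_matI)

lemma col_block_list_mat: "col_block F k z = list_mat F (deg_list k) [z]"
  by (auto simp: col_block_def list_mat_def intro!: eq_matI)

section \<open>Inverses and elimination of a block row\<close>

lemma det_nonzero_inverse:
  fixes A :: "'a::field mat"
  assumes "A \<in> carrier_mat n n" "Determinant.det A \<noteq> 0"
  shows "A * the (mat_inverse A) = 1\<^sub>m n" "the (mat_inverse A) \<in> carrier_mat n n"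
proof -
  obtain B where "mat_inverse A = Some B"
    using mat_inverse(1)[OF assms(1), of "()"] det_non_zero_imp_unit[OF assms, of "()"] by blast
  then show "A * the (mat_inverse A) = 1\<^sub>m n" "the (mat_inverse A) \<in> carrier_mat n n"
    using mat_inverse(2)[OF assms(1)] by auto
qed

text \<open>The row \<open>(W V)\<close> annihilates \<open>A\<close> stacked on \<open>C\<close>,
  so \<open>W\<close> equals \<open>- V C\<close> times the inverse of \<open>A\<close>.
  Substituting this into \<open>W B + V E\<close> leaves \<open>V\<close> times the Schur complement
  of \<open>A\<close>.\<close>

lemma mat_schur_elim:
  fixes A :: "'a::field mat"
  assumes A: "A \<in> carrier_mat a a" and B: "B \<in> carrier_mat a b" and C: "C \<in> carrier_mat c a"
    and E: "E \<in> carrier_mat c b" and W: "W \<in> carrier_mat r a" and V: "V \<in> carrier_mat r c"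
    and det: "Determinant.det A \<noteq> 0"
    and elim: "W * A + V * C = 0\<^sub>m r a"
  shows "W * B + V * E = V * (E - C * the (mat_inverse A) * B)"
proof -
  note I = det_nonzero_inverse[OF A det]
  let ?I = "the (mat_inverse A)"
  have "W = W * (A * ?I)"
    using I W by simp
  also have "\<dots> = (W * A) * ?I"
    using assoc_mult_mat[OF W A I(2)] by simp
  also have "W * A = - (V * C)"
  proof (rule eq_matI)
    fix i j assume ij: "i < dim_row (- (V * C))" "j < dim_col (- (V * C))"
    then have "(W * A + V * C) $$ (i, j) = 0"
      using elim V C by simp
    with ij show "(W * A) $$ (i, j) = (- (V * C)) $$ (i, j)"
      using V C W A by (simp add: eq_neg_iff_add_eq_0)
  qed (use A C W V in auto)
  finally have "W * B = - (V * C) * ?I * B" by simp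
  also have "\<dots> = - (V * (C * ?I * B))"
    using V C I B by (simp add: assoc_mult_mat[of _ r c _ a _ b] assoc_mult_mat[of _ c a _ a _ b]
       assoc_mult_mat[of _ r c _ a _ a] assoc_mult_mat[of _ r a _ a _ b])
  finally have WB: "W * B = - (V * (C * ?I * B))" .
  have "V * (E - C * ?I * B) = V * E - V * (C * ?I * B)"
    using V C I B E by (intro mult_minus_distrib_mat) auto
  then show ?thesis
    unfolding WB using V C I(2) B E by (intro eq_matI) auto
qed

section \<open>Banded semi-infinite matrices\<close>

lemma smat_mult_eq_sum:
  assumes "finite X" "\<And>\<gamma>. \<gamma> \<notin> X \<Longrightarrow> A \<alpha> \<gamma> * B \<gamma> \<beta> = 0"
  shows "smat_mult A B \<alpha> \<beta> = (\<Sum>\<gamma>\<in>X. A \<alpha> \<gamma> * B \<gamma> \<beta>)"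
  unfolding smat_mult_def using assms by (intro Sum_any.expand_superset) auto

text \<open>A vector is a matrix with equal columns, so associativity of products covers the action
  on vectors. The column \<open>\<beta>\<close> is arbitrary; later \<open>undefined\<close> is
  inserted for it.\<close>

lemma smat_vec_eq_mult: "smat_vec A v \<alpha> = smat_mult A (\<lambda>\<gamma> _. v \<gamma>) \<alpha> \<beta>"
  by (simp add: smat_vec_def smat_mult_def)

lemma smat_one_mult [simp]: "smat_mult smat_one A = A"
proof (intro ext)
  show "smat_mult smat_one A \<alpha> \<beta> = A \<alpha> \<beta>" for \<alpha> \<beta>
    by (subst smat_mult_eq_sum[of "{\<alpha>}"]) (auto simp: smat_one_def)
qed

lemma smat_mult_one [simp]: "smat_mult A smat_one = A"
proof (intro ext)
  show "smat_mult A smat_one \<alpha> \<beta> = A \<alpha> \<beta>" for \<alpha> \<beta>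
    by (subst smat_mult_eq_sum[of "{\<beta>}"]) (auto simp: smat_one_def)
qed

text \<open>Only the number of block superdiagonals is bounded. As finitely many multi-indices have
  bounded degree, every row is then finitely supported; block lower triangular is the case
  \<open>d = 0\<close>.\<close>

definition banded :: "nat \<Rightarrow> 'd::finite smat \<Rightarrow> bool" where
  "banded d A \<longleftrightarrow> (\<forall>\<alpha> \<beta>. mdeg \<alpha> + d < mdeg \<beta> \<longrightarrow> A \<alpha> \<beta> = 0)"

lemma bandedD: "banded d A \<Longrightarrow> mdeg \<alpha> + d < mdeg \<beta> \<Longrightarrow> A \<alpha> \<beta> = 0"
  by (simp add: banded_def)

lemma banded_one: "banded 0 smat_one"
  by (auto simp: banded_def smat_one_def)

lemma banded_mult_eq:
  assumes "banded d A" "mdeg \<alpha> + d \<le> l"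
  shows "smat_mult A B \<alpha> \<beta> = (\<Sum>\<gamma> | mdeg \<gamma> \<le> l. A \<alpha> \<gamma> * B \<gamma> \<beta>)"
  using assms by (intro smat_mult_eq_sum finite_mdeg_le) (auto simp: banded_def)

lemma banded_mult:
  assumes "banded a A" "banded b B"
  shows "banded (a + b) (smat_mult A B)"
  unfolding banded_def
proof (intro allI impI)
  fix \<alpha> \<beta> :: "'a multiindex" assume "mdeg \<alpha> + (a + b) < mdeg \<beta>"
  then have "A \<alpha> \<gamma> * B \<gamma> \<beta> = 0" for \<gamma>
    using bandedD[OF assms(1), of \<alpha> \<gamma>] bandedD[OF assms(2), of \<gamma> \<beta>]
    by (cases "mdeg \<alpha> + a < mdeg \<gamma>") auto
  then show "smat_mult A B \<alpha> \<beta> = 0"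
    by (simp only: smat_mult_def Sum_any.neutral)
qed

text \<open>Semi-infinite products are not associative in general. With two banded left factors all
  sums are finite and can be interchanged; the rightmost factor may be block upper triangular or a
  column of monomials.\<close>

lemma smat_mult_assoc:
  assumes A: "banded a A" and B: "banded b B"
  shows "smat_mult (smat_mult A B) C = smat_mult A (smat_mult B C)"
proof (intro ext)
  fix \<alpha> \<beta> :: "'a multiindex"
  let ?X = "{\<gamma>::'a multiindex. mdeg \<gamma> \<le> mdeg \<alpha> + a}" and ?Y = "{\<gamma>::'a multiindex. mdeg \<gamma> \<le> mdeg \<alpha> + (a + b)}"
  have "smat_mult (smat_mult A B) C \<alpha> \<beta> = (\<Sum>\<gamma>\<in>?Y. (\<Sum>\<delta>\<in>?X. A \<alpha> \<delta> * B \<delta> \<gamma>) * C \<gamma> \<beta>)"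
    by (simp add: banded_mult_eq[OF banded_mult[OF A B] le_refl] banded_mult_eq[OF A le_refl])
  also have "\<dots> = (\<Sum>\<delta>\<in>?X. A \<alpha> \<delta> * (\<Sum>\<gamma>\<in>?Y. B \<delta> \<gamma> * C \<gamma> \<beta>))"
    by (simp add: sum_distrib_left sum_distrib_right sum.swap[of _ ?Y ?X] mult.assoc)
  \<comment> \<open>The range \<open>?Y\<close> reaches \<open>b\<close> degrees beyond
    \<open>?X\<close>, so it contains the support of row \<open>\<delta>\<close> of \<open>B\<close>
    for every \<open>\<delta>\<close> in \<open>?X\<close>.\<close>
  also have "\<dots> = (\<Sum>\<delta>\<in>?X. A \<alpha> \<delta> * smat_mult B C \<delta> \<beta>)"
    by (intro sum.cong refl arg_cong2[of _ _ _ _ "(*)"] banded_mult_eq[OF B, symmetric]) auto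
  also have "\<dots> = smat_mult A (smat_mult B C) \<alpha> \<beta>"
    by (rule banded_mult_eq[OF A le_refl, symmetric])
  finally show "smat_mult (smat_mult A B) C \<alpha> \<beta> = smat_mult A (smat_mult B C) \<alpha> \<beta>" .
qed

section \<open>Block conditions read entrywise\<close>

lemma zero_list_mat: "0\<^sub>m (length xs) (length ys) = list_mat (\<lambda>_ _. 0) xs ys"
  by (rule eq_matI) auto

lemma one_list_mat: "distinct xs \<Longrightarrow> 1\<^sub>m (length xs) = list_mat smat_one xs xs"
  by (rule eq_matI) (auto simp: smat_one_def nth_eq_iff_index_eq)

lemma block_zero_iff:
  fixes A :: "'d::{finite,linorder} smat"
  shows "block A k l = 0\<^sub>m (card (deg_set k :: 'd multiindex set)) (card (deg_set l :: 'd multiindex set))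
    \<longleftrightarrow> (\<forall>\<alpha> \<beta>. mdeg \<alpha> = k \<longrightarrow> mdeg \<beta> = l \<longrightarrow> A \<alpha> \<beta> = 0)"
proof -
  have "0\<^sub>m (card (deg_set k :: 'd multiindex set)) (card (deg_set l :: 'd multiindex set)) =
      list_mat (\<lambda>_ _. 0::real) (deg_list k :: 'd multiindex list) (deg_list l :: 'd multiindex list)"
    unfolding zero_list_mat[symmetric] by simp
  then show ?thesis
    by (auto simp: block_list_mat list_mat_eq_iff)
qed

lemma block_one_iff:
  fixes A :: "'d::{finite,linorder} smat"
  shows "block A k k = 1\<^sub>m (card (deg_set k :: 'd multiindex set))
    \<longleftrightarrow> (\<forall>\<alpha> \<beta>. mdeg \<alpha> = k \<longrightarrow> mdeg \<beta> = k \<longrightarrow> A \<alpha> \<beta> = smat_one \<alpha> \<beta>)"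
proof -
  have "1\<^sub>m (card (deg_set k :: 'd multiindex set)) =
      list_mat smat_one (deg_list k :: 'd multiindex list) (deg_list k)"
    unfolding one_list_mat[OF distinct_deg_list, symmetric] by simp
  then show ?thesis
    by (auto simp: block_list_mat list_mat_eq_iff)
qed

lemma block_lower_unitri_iff:
  "block_lower_unitri S \<longleftrightarrow>
     banded 0 S \<and> (\<forall>\<alpha> \<beta>. mdeg \<alpha> = mdeg \<beta> \<longrightarrow> S \<alpha> \<beta> = smat_one \<alpha> \<beta>)"
  unfolding block_lower_unitri_def block_zero_iff block_one_iff banded_def by auto

lemma block_lower_unitri_banded: "block_lower_unitri S \<Longrightarrow> banded 0 S"
  by (simp add: block_lower_unitri_iff)

lemma block_lower_unitri_diag:
  "block_lower_unitri S \<Longrightarrow> mdeg \<alpha> = mdeg \<beta> \<Longrightarrow> S \<alpha> \<beta> = smat_one \<alpha> \<beta>"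
  by (simp add: block_lower_unitri_iff)

section \<open>Inverses of block lower unitriangular matrices\<close>

function forward_subst :: "'d::finite smat \<Rightarrow> 'd smat" where
  "forward_subst S \<alpha> \<beta> =
     smat_one \<alpha> \<beta> - (\<Sum>\<gamma>\<in>{\<gamma>. mdeg \<gamma> < mdeg \<alpha>}. S \<alpha> \<gamma> * forward_subst S \<gamma> \<beta>)"
  by auto
termination
  by (relation "Wellfounded.measure (\<lambda>(S, \<alpha>, \<beta>). mdeg \<alpha>)") auto

declare forward_subst.simps [simp del]

lemma forward_subst_upper:
  "mdeg \<alpha> \<le> mdeg \<beta> \<Longrightarrow> forward_subst S \<alpha> \<beta> = smat_one \<alpha> \<beta>"
proof (induction "mdeg \<alpha>" arbitrary: \<alpha> rule: less_induct)
  case less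
  have "forward_subst S \<gamma> \<beta> = 0" if "mdeg \<gamma> < mdeg \<alpha>" for \<gamma>
    using less.hyps[OF that] less.prems that by (auto simp: smat_one_def)
  then show ?case
    by (subst forward_subst.simps) simp
qed

lemma forward_subst_unitri: "block_lower_unitri (forward_subst S)"
  unfolding block_lower_unitri_iff banded_def
  by (auto simp: forward_subst_upper smat_one_def)

text \<open>The diagonal block of \<open>S\<close> contributes
  \<open>forward_subst S \<alpha> \<beta>\<close> itself, and the recursion is set up so that the
  contributions of lower degree cancel against it.\<close>

lemma smat_mult_forward_subst:
  assumes "block_lower_unitri S"
  shows "smat_mult S (forward_subst S) = smat_one"
proof (intro ext)
  fix \<alpha> \<beta> :: "'a multiindex"
  let ?f = "\<lambda>\<gamma>. S \<alpha> \<gamma> * forward_subst S \<gamma> \<beta>"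
  have fin: "finite {\<gamma>::'a multiindex. mdeg \<gamma> < mdeg \<alpha>}"
    by (rule finite_subset[OF _ finite_mdeg_le[of "mdeg \<alpha>"]]) auto
  have "smat_mult S (forward_subst S) \<alpha> \<beta> = (\<Sum>\<gamma> | mdeg \<gamma> \<le> mdeg \<alpha>. ?f \<gamma>)"
    by (rule banded_mult_eq[OF block_lower_unitri_banded[OF assms]]) simp
  also have "{\<gamma>::'a multiindex. mdeg \<gamma> \<le> mdeg \<alpha>} = {\<gamma>. mdeg \<gamma> < mdeg \<alpha>} \<union> deg_set (mdeg \<alpha>)"
    by auto
  also have "sum ?f \<dots> = (\<Sum>\<gamma> | mdeg \<gamma> < mdeg \<alpha>. ?f \<gamma>) + (\<Sum>\<gamma>\<in>deg_set (mdeg \<alpha>). ?f \<gamma>)"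
    by (rule sum.union_disjoint) (use fin in auto)
  also have "(\<Sum>\<gamma>\<in>deg_set (mdeg \<alpha>). ?f \<gamma>) = (\<Sum>\<gamma>\<in>deg_set (mdeg \<alpha>). if \<gamma> = \<alpha> then ?f \<gamma> else 0)"
    by (rule sum.cong) (auto simp: block_lower_unitri_diag[OF assms] smat_one_def)
  also have "\<dots> = forward_subst S \<alpha> \<beta>"
    by (simp add: sum.delta block_lower_unitri_diag[OF assms] smat_one_def)
  finally show "smat_mult S (forward_subst S) \<alpha> \<beta> = smat_one \<alpha> \<beta>"
    using forward_subst.simps[of S \<alpha> \<beta>] by simp
qed

text \<open>Forward substitution yields a right inverse \<open>?R\<close>. Being unitriangular,
  \<open>?R\<close> has a right inverse too, which must be \<open>S\<close>; so \<open>?R\<close> is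
  two-sided, and associativity makes it the only right inverse of \<open>S\<close>.\<close>

lemma smat_inv_props:
  assumes S: "block_lower_unitri S"
  shows "block_lower_unitri (smat_inv S)" "smat_mult S (smat_inv S) = smat_one"
    "smat_mult (smat_inv S) S = smat_one"
proof -
  let ?R = "forward_subst S"
  have b: "banded 0 A" if "block_lower_unitri A" for A :: "'a smat"
    using that by (rule block_lower_unitri_banded)
  have R: "block_lower_unitri ?R" "smat_mult S ?R = smat_one"
    using forward_subst_unitri smat_mult_forward_subst[OF S] by auto
  have "S = smat_mult S (smat_mult ?R (forward_subst ?R))"
    by (simp add: smat_mult_forward_subst[OF R(1)])
  also have "\<dots> = forward_subst ?R"
    by (simp add: smat_mult_assoc[OF b[OF S] b[OF R(1)], symmetric] R(2))
  finally have RS: "smat_mult ?R S = smat_one"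
    using smat_mult_forward_subst[OF R(1)] by simp
  have "R' = ?R" if "smat_mult S R' = smat_one" for R'
    using smat_mult_assoc[OF b[OF R(1)] b[OF S], of R'] that RS by simp
  then have "smat_inv S = ?R"
    unfolding smat_inv_def using R RS by (intro the_equality) blast+
  then show "block_lower_unitri (smat_inv S)" "smat_mult S (smat_inv S) = smat_one"
    "smat_mult (smat_inv S) S = smat_one"
    using R RS by simp_all
qed

section \<open>Block diagonal matrices with invertible blocks\<close>

lemma block_diag_invertible_off_diag:
  "block_diag_invertible H \<Longrightarrow> mdeg \<alpha> \<noteq> mdeg \<beta> \<Longrightarrow> H \<alpha> \<beta> = 0"
  unfolding block_diag_invertible_def block_zero_iff by blast

lemma block_diag_invertible_left_kernel:
  fixes H :: "'d::{finite,linorder} smat"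
  assumes H: "block_diag_invertible H"
    and v: "\<And>\<beta>. mdeg \<beta> = l \<Longrightarrow> (\<Sum>\<gamma>\<in>deg_set l. v \<gamma> * H \<gamma> \<beta>) = 0"
    and "mdeg \<gamma> = l"
  shows "v \<gamma> = 0"
proof -
  let ?d = "deg_list l :: 'd multiindex list" and ?H = "block H l l"
  \<comment> \<open>The vector becomes a one-row matrix with dummy label \<open>()\<close>, to be
    multiplied from the right by the inverse of the block.\<close>
  let ?v = "list_mat (\<lambda>_. v) [()] ?d"
  obtain B where B: "?H * B = 1\<^sub>m (dim_row ?H)" "B * ?H = 1\<^sub>m (dim_row B)"
    using H unfolding block_diag_invertible_def invertible_mat_def inverts_mat_def by blast
  \<comment> \<open>\<open>invertible_mat\<close> does not state the size of the inverse; comparing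
    the columns of both identities recovers it.\<close>
  have dimB: "B \<in> carrier_mat (length ?d) (length ?d)"
    using arg_cong[OF B(1), of dim_col] arg_cong[OF B(2), of dim_col]
    by (intro carrier_matI) (auto simp: block_list_mat)
  have "?v * ?H = 0\<^sub>m (length [()]) (length ?d)"
    unfolding block_list_mat list_mat_mult_distinct[OF distinct_deg_list] zero_list_mat
      list_mat_eq_iff using v by auto
  then have "?v * ?H * B = 0\<^sub>m 1 (length ?d)"
    using dimB by simp
  moreover have "?v * ?H * B = ?v * (?H * B)"
    by (rule assoc_mult_mat[OF list_mat_carrier _ dimB]) (simp only: block_list_mat list_mat_carrier)
  moreover have "?H * B = 1\<^sub>m (length ?d)"
    using B(1) by (simp add: block_list_mat)
  moreover have "?v * 1\<^sub>m (length ?d) = ?v"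
    by (rule right_mult_one_mat[OF list_mat_carrier])
  ultimately have "?v = 0\<^sub>m (length [()]) (length ?d)"
    by simp
  then show ?thesis
    using \<open>mdeg \<gamma> = l\<close> unfolding zero_list_mat list_mat_eq_iff by auto
qed

section \<open>Darboux transformations\<close>

lemma mdeg_incr: "mdeg (\<alpha>(a := Suc (\<alpha> a))) = mdeg \<alpha> + 1"
proof -
  have "mdeg (\<alpha>(a := Suc (\<alpha> a))) = (\<Sum>b\<in>UNIV. \<alpha> b + (if b = a then 1 else 0))"
    unfolding mdeg_def by (rule sum.cong) auto
  then show ?thesis
    by (simp add: sum.distrib mdeg_def)
qed

lemma mv_monom_incr: "mv_monom (\<alpha>(a := Suc (\<alpha> a))) x = vec_nth x a * mv_monom \<alpha> x"
proof -
  have "mv_monom (\<alpha>(a := Suc (\<alpha> a))) x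
      = (\<Prod>b\<in>UNIV. (if b = a then vec_nth x a else 1) * vec_nth x b ^ \<alpha> b)"
    unfolding mv_monom_def by (rule prod.cong) auto
  then show ?thesis
    by (simp add: prod.distrib mv_monom_def)
qed

lemma mv_monom_mult: "mv_monom \<alpha> x * mv_monom \<beta> x = mv_monom (\<lambda>a. \<alpha> a + \<beta> a) x"
  by (simp add: mv_monom_def power_add prod.distrib)

lemma inner_mult_monom:
  "(inner n x - q) * mv_monom \<alpha> x =
     (\<Sum>a\<in>UNIV. vec_nth n a * mv_monom (\<alpha>(a := Suc (\<alpha> a))) x) - q * mv_monom \<alpha> x"
  by (simp add: inner_vec_def mv_monom_incr left_diff_distrib sum_distrib_right mult.assoc)

text \<open>This is \<open>n \<cdot> \<Lambda> - q\<close>, which represents multiplication by the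
  linear form \<open>n \<cdot> x - q\<close> on the vector of monomials.\<close>

definition linear_smat :: "'d::finite point \<Rightarrow> real \<Rightarrow> 'd smat" where
  "linear_smat n q \<alpha> \<beta> = shift_dot n \<alpha> \<beta> - q * smat_one \<alpha> \<beta>"

lemma shift_dot_eq_0: "mdeg \<beta> \<noteq> mdeg \<alpha> + 1 \<Longrightarrow> shift_dot n \<alpha> \<beta> = 0"
  by (auto simp: shift_dot_def shift_matrix_def mdeg_incr intro!: sum.neutral)

lemma banded_shift_dot: "banded 1 (shift_dot n)"
  by (auto simp: banded_def intro: shift_dot_eq_0)

lemma banded_linear_smat: "banded 1 (linear_smat n q)"
  by (auto simp: banded_def linear_smat_def shift_dot_eq_0 smat_one_def)

lemma linear_smat_mult:
  "smat_mult (linear_smat n q) B \<alpha> \<beta> =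
     (\<Sum>a\<in>UNIV. vec_nth n a * B (\<alpha>(a := Suc (\<alpha> a))) \<beta>) - q * B \<alpha> \<beta>"
proof -
  let ?X = "{\<gamma>::'a multiindex. mdeg \<gamma> \<le> mdeg \<alpha> + 1}"
  have "smat_mult (linear_smat n q) B \<alpha> \<beta> = (\<Sum>\<gamma>\<in>?X. linear_smat n q \<alpha> \<gamma> * B \<gamma> \<beta>)"
    by (rule banded_mult_eq[OF banded_linear_smat le_refl])
  also have "\<dots> = (\<Sum>\<gamma>\<in>?X. \<Sum>a\<in>UNIV. if \<gamma> = \<alpha>(a := Suc (\<alpha> a)) then vec_nth n a * B \<gamma> \<beta> else 0)
      - (\<Sum>\<gamma>\<in>?X. if \<gamma> = \<alpha> then q * B \<gamma> \<beta> else 0)"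
    unfolding sum_subtractf[symmetric]
  proof (rule sum.cong[OF refl])
    fix \<gamma>
    have "shift_dot n \<alpha> \<gamma> * B \<gamma> \<beta> =
        (\<Sum>a\<in>UNIV. if \<gamma> = \<alpha>(a := Suc (\<alpha> a)) then vec_nth n a * B \<gamma> \<beta> else 0)"
      unfolding shift_dot_def shift_matrix_def sum_distrib_right by (rule sum.cong) auto
    then show "linear_smat n q \<alpha> \<gamma> * B \<gamma> \<beta> =
        (\<Sum>a\<in>UNIV. if \<gamma> = \<alpha>(a := Suc (\<alpha> a)) then vec_nth n a * B \<gamma> \<beta> else 0)
        - (if \<gamma> = \<alpha> then q * B \<gamma> \<beta> else 0)"
      by (auto simp: linear_smat_def smat_one_def left_diff_distrib)
  qed
  also have "(\<Sum>\<gamma>\<in>?X. \<Sum>a\<in>UNIV. if \<gamma> = \<alpha>(a := Suc (\<alpha> a)) then vec_nth n a * B \<gamma> \<beta> else 0)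
      = (\<Sum>a\<in>UNIV. vec_nth n a * B (\<alpha>(a := Suc (\<alpha> a))) \<beta>)"
    by (subst sum.swap) (simp add: sum.delta finite_mdeg_le mdeg_incr del: fun_upd_apply)
  also have "(\<Sum>\<gamma>\<in>?X. if \<gamma> = \<alpha> then q * B \<gamma> \<beta> else 0) = q * B \<alpha> \<beta>"
    by (simp add: sum.delta finite_mdeg_le)
  finally show ?thesis .
qed

text \<open>A list of factors lets inductions peel off the leftmost one, in the order in which
  \<open>foldr\<close> builds \<open>darboux_comp\<close> and \<open>shift_prod\<close>.\<close>

definition linear_prod_smat :: "(nat \<Rightarrow> 'd::finite point) \<Rightarrow> (nat \<Rightarrow> real) \<Rightarrow> nat list \<Rightarrow> 'd smat" where
  "linear_prod_smat n q = (\<lambda>is. foldr (\<lambda>i. smat_mult (linear_smat (n i) (q i))) is smat_one)"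

lemma linear_prod_smat_simps [simp]:
  "linear_prod_smat n q [] = smat_one"
  "linear_prod_smat n q (i # is) = smat_mult (linear_smat (n i) (q i)) (linear_prod_smat n q is)"
  by (simp_all add: linear_prod_smat_def)

lemma banded_linear_prod_smat: "banded (length js) (linear_prod_smat n q js)"
  using banded_mult[OF banded_linear_smat] by (induction js) (auto simp: banded_one)

text \<open>Each factor raises the degree by at most one. To gain as many degrees as there are
  factors, every factor must act by its shift part, so the constants \<open>q\<close> drop
  out.\<close>

lemma linear_prod_smat_leading:
  "mdeg \<beta> = mdeg \<alpha> + length js \<Longrightarrow>
     linear_prod_smat n q js \<alpha> \<beta> = foldr (\<lambda>i. smat_mult (shift_dot (n i))) js smat_one \<alpha> \<beta>"
proof (induction js arbitrary: \<alpha>)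
  case (Cons i js)
  let ?L = "linear_prod_smat n q js" and ?T = "foldr (\<lambda>i. smat_mult (shift_dot (n i))) js smat_one"
  have "linear_smat (n i) (q i) \<alpha> \<gamma> * ?L \<gamma> \<beta> = shift_dot (n i) \<alpha> \<gamma> * ?T \<gamma> \<beta>"
    if "mdeg \<gamma> \<le> mdeg \<alpha> + 1" for \<gamma>
  proof (cases "mdeg \<gamma> = mdeg \<alpha> + 1")
    case True
    then show ?thesis
      using Cons.IH[of \<gamma>] Cons.prems by (auto simp: linear_smat_def smat_one_def[of \<alpha> \<gamma>])
  next
    case False
    \<comment> \<open>Here the first factor has not raised the degree, and the remaining ones are
      one degree short of \<open>\<beta>\<close>.\<close>
    then have "?L \<gamma> \<beta> = 0"
      using that Cons.prems by (intro bandedD[OF banded_linear_prod_smat]) auto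
    then show ?thesis
      using False by (simp add: shift_dot_eq_0)
  qed
  then have "smat_mult (linear_smat (n i) (q i)) ?L \<alpha> \<beta> = smat_mult (shift_dot (n i)) ?T \<alpha> \<beta>"
    unfolding banded_mult_eq[OF banded_linear_smat le_refl] banded_mult_eq[OF banded_shift_dot le_refl]
    by (intro sum.cong) auto
  then show ?case
    by simp
qed auto

text \<open>The vector of monomials is an eigenvector of every \<open>linear_smat\<close>, the
  eigenvalue being the value of the linear form at \<open>x\<close>; the eigenvalues
  multiply.\<close>

lemma linear_prod_smat_monom:
  "smat_mult (linear_prod_smat n q js) (\<lambda>\<beta> _. mv_monom \<beta> x) =
     (\<lambda>\<alpha> _. (\<Prod>i\<leftarrow>js. inner (n i) x - q i) * mv_monom \<alpha> x)"
proof (induction js)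
  case (Cons i js)
  let ?c = "\<Prod>i\<leftarrow>js. inner (n i) x - q i"
  have "smat_mult (linear_prod_smat n q (i # js)) (\<lambda>\<beta> _. mv_monom \<beta> x) \<alpha> \<beta>
      = ?c * ((inner (n i) x - q i) * mv_monom \<alpha> x)" for \<alpha> \<beta>
    unfolding linear_prod_smat_simps smat_mult_assoc[OF banded_linear_smat banded_linear_prod_smat]
      Cons.IH linear_smat_mult inner_mult_monom
    by (simp add: right_diff_distrib sum_distrib_left mult.left_commute)
  then show ?case
    by (auto simp: ac_simps)
qed simp

section \<open>Moments of transformed measures\<close>

lemma darboux_weight:
  "mv_monom \<alpha> x * snd (darboux n q \<mu>) x =
     (\<Sum>a\<in>UNIV. vec_nth n a * (mv_monom (\<alpha>(a := Suc (\<alpha> a))) x * snd \<mu> x))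
       - q * (mv_monom \<alpha> x * snd \<mu> x)"
proof -
  have "mv_monom \<alpha> x * snd (darboux n q \<mu>) x = ((inner n x - q) * mv_monom \<alpha> x) * snd \<mu> x"
    by (simp add: darboux_def)
  then show ?thesis
    unfolding inner_mult_monom by (simp add: left_diff_distrib sum_distrib_right mult.assoc)
qed

lemma finite_moments_darboux:
  assumes "finite_moments \<mu>"
  shows "finite_moments (darboux n q \<mu>)"
  unfolding finite_moments_def darboux_weight using assms
  by (auto simp: finite_moments_def darboux_def)

lemma moment_matrix_alt:
  "moment_matrix \<mu> \<alpha> \<beta> = (LINT x|fst \<mu>. mv_monom (\<lambda>a. \<alpha> a + \<beta> a) x * snd \<mu> x)"
  by (simp add: moment_matrix_def mv_monom_mult)

text \<open>A moment depends only on the sum of \<open>\<alpha>\<close> and \<open>\<beta>\<close>,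
  and the linear form raises one exponent of that sum. Charging the raise to the row index makes it
  a left factor; finite moments allow the integral to be split.\<close>

lemma moment_matrix_darboux:
  assumes "finite_moments \<mu>"
  shows "moment_matrix (darboux n q \<mu>) = smat_mult (linear_smat n q) (moment_matrix \<mu>)"
proof (intro ext)
  fix \<alpha> \<beta> :: "'a multiindex"
  let ?\<gamma> = "\<lambda>a. \<alpha> a + \<beta> a"
  have int: "integrable (fst \<mu>) (\<lambda>x. mv_monom \<gamma> x * snd \<mu> x)" for \<gamma>
    using assms by (simp add: finite_moments_def)
  have incr: "?\<gamma>(a := Suc (?\<gamma> a)) = (\<lambda>b. (\<alpha>(a := Suc (\<alpha> a))) b + \<beta> b)" for a
    by auto
  have "moment_matrix (darboux n q \<mu>) \<alpha> \<beta> =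
      (\<Sum>a\<in>UNIV. vec_nth n a * (LINT x|fst \<mu>. mv_monom (?\<gamma>(a := Suc (?\<gamma> a))) x * snd \<mu> x))
        - q * (LINT x|fst \<mu>. mv_monom ?\<gamma> x * snd \<mu> x)"
    unfolding moment_matrix_alt darboux_weight
    by (subst Bochner_Integration.integral_diff) (auto simp: int darboux_def Bochner_Integration.integral_sum)
  then show "moment_matrix (darboux n q \<mu>) \<alpha> \<beta> = smat_mult (linear_smat n q) (moment_matrix \<mu>) \<alpha> \<beta>"
    unfolding linear_smat_mult moment_matrix_alt incr .
qed

text \<open>Finiteness of the moments travels with the induction, since the next transformation
  needs it for the measure already transformed.\<close>

lemma moment_matrix_foldr_darboux:
  assumes "finite_moments \<mu>"
  shows "finite_moments (foldr (\<lambda>i. darboux (n i) (q i)) js \<mu>) \<and>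
    moment_matrix (foldr (\<lambda>i. darboux (n i) (q i)) js \<mu>) =
      smat_mult (linear_prod_smat n q js) (moment_matrix \<mu>)"
proof (induction js)
  case (Cons i js)
  then show ?case
    by (simp add: finite_moments_darboux moment_matrix_darboux
        smat_mult_assoc[OF banded_linear_smat banded_linear_prod_smat])
qed (simp add: assms)

section \<open>The connector\<close>

definition connector :: "'d::{finite,linorder} smat \<Rightarrow> 'd smat \<Rightarrow> 'd smat \<Rightarrow> 'd smat" where
  "connector TS M S = smat_mult TS (smat_mult M (smat_inv S))"

text \<open>All that remains of the measures is a left factor \<open>M\<close> with at most
  \<open>m\<close> block superdiagonals. It is later the matrix of multiplication by the whole
  product of linear forms.\<close>

locale connected_factorizations =
  fixes M S H TS TH :: "'d::{finite,linorder} smat" and G :: "'d smat" and m :: nat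
  assumes M: "banded m M"
    and cholesky: "block_cholesky G S H"
    and cholesky_T: "block_cholesky (smat_mult M G) TS TH"
begin

abbreviation "R \<equiv> smat_inv S"
abbreviation "\<omega> \<equiv> connector TS M S"
abbreviation "U \<equiv> smat_mult H (smat_transpose R)"
abbreviation "TU \<equiv> smat_mult TH (smat_transpose (smat_inv TS))"

lemma unitri: "block_lower_unitri S" "block_lower_unitri TS"
  using cholesky cholesky_T by (auto simp: block_cholesky_def)

lemma diag: "block_diag_invertible H" "block_diag_invertible TH"
  using cholesky cholesky_T by (auto simp: block_cholesky_def)

lemma R_unitri: "block_lower_unitri R" "block_lower_unitri (smat_inv TS)"
  using smat_inv_props(1) unitri by auto

lemma banded_facts: "banded 0 S" "banded 0 TS" "banded 0 R" "banded 0 (smat_inv TS)"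
  using unitri R_unitri by (auto simp: block_lower_unitri_iff)

lemma banded_diag: "block_diag_invertible D \<Longrightarrow> banded 0 D" for D :: "'d smat"
  by (auto simp: banded_def block_diag_invertible_off_diag)

lemma banded_MR: "banded m (smat_mult M R)"
  using banded_mult[OF M banded_facts(3)] by simp

lemma banded_connector: "banded m \<omega>"
  unfolding connector_def using banded_mult[OF banded_facts(2) banded_MR] by simp

text \<open>Since \<open>G = R U\<close>, the product is \<open>TS (M G)\<close>, and the second
  factorization cancels \<open>TS\<close>. Reassociating is legitimate because \<open>U\<close> and
  \<open>TU\<close>, which need not be banded, stand only at the far right.\<close>

lemma connector_mult_U: "smat_mult \<omega> U = TU"
proof -
  have "G = smat_mult R U"
    using cholesky smat_mult_assoc[OF banded_facts(3) banded_diag[OF diag(1)]]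
    by (simp add: block_cholesky_def)
  then have "smat_mult \<omega> U = smat_mult TS (smat_mult M G)"
    unfolding connector_def
    by (simp add: smat_mult_assoc[OF banded_facts(2) banded_MR] smat_mult_assoc[OF M banded_facts(3)])
  also have "smat_mult M G = smat_mult (smat_inv TS) TU"
    using cholesky_T smat_mult_assoc[OF banded_facts(4) banded_diag[OF diag(2)]]
    by (simp add: block_cholesky_def)
  also have "smat_mult TS \<dots> = TU"
    using smat_inv_props(2)[OF unitri(2)]
    by (simp add: smat_mult_assoc[OF banded_facts(2,4), symmetric])
  finally show ?thesis .
qed

lemma smat_vec_orth_poly:
  "smat_vec \<omega> (\<lambda>\<beta>. orth_poly S \<beta> x) \<alpha> = smat_vec (smat_mult TS M) (\<lambda>\<beta>. mv_monom \<beta> x) \<alpha>"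
proof -
  let ?\<chi> = "\<lambda>\<beta> _ :: 'd multiindex. mv_monom \<beta> x"
  have "(\<lambda>\<beta> _. orth_poly S \<beta> x) = smat_mult S ?\<chi>"
    by (intro ext) (simp add: orth_poly_def smat_vec_eq_mult)
  then have "smat_vec \<omega> (\<lambda>\<beta>. orth_poly S \<beta> x) \<alpha> = smat_mult \<omega> (smat_mult S ?\<chi>) \<alpha> undefined"
    by (simp add: smat_vec_eq_mult[of _ _ _ undefined])
  also have "smat_mult \<omega> (smat_mult S ?\<chi>) = smat_mult (smat_mult \<omega> S) ?\<chi>"
    by (rule smat_mult_assoc[OF banded_connector banded_facts(1), symmetric])
  also have "smat_mult \<omega> S = smat_mult TS M"
    unfolding connector_def
    using smat_inv_props(3)[OF unitri(1)]
    by (simp add: smat_mult_assoc[OF banded_facts(2) banded_MR] smat_mult_assoc[OF M banded_facts(3)])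
  finally show ?thesis
    by (simp add: smat_vec_eq_mult[of _ _ _ undefined])
qed

text \<open>A fixed exponent \<open>\<xi>\<close> leaves at most one nonzero entry in
  \<open>chi_star\<close>, so second kind functions read at \<open>\<xi>\<close> form a single
  column of \<open>U\<close>, or vanish. The claim is then one column of
  \<open>\<omega> U = TU\<close>.\<close>

lemma smat_vec_second_kind:
  "smat_vec \<omega> (\<lambda>\<beta>. second_kind S H \<beta> \<xi>) \<alpha> = second_kind TS TH \<alpha> \<xi>"
proof -
  have col: "smat_vec A (\<lambda>\<gamma>. chi_star \<gamma> \<xi>) \<beta> =
      (if \<exists>\<gamma>. \<xi> = (\<lambda>a. - int (\<gamma> a) - 1) then A \<beta> (\<lambda>a. nat (- \<xi> a - 1)) else 0)"
    for A :: "'d smat" and \<beta>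
  proof (cases "\<exists>\<gamma>. \<xi> = (\<lambda>a. - int (\<gamma> a) - 1)")
    case True
    then obtain \<gamma> where \<gamma>: "\<xi> = (\<lambda>a. - int (\<gamma> a) - 1)" by blast
    have "chi_star \<delta> \<xi> = (if \<delta> = \<gamma> then 1 else 0)" for \<delta>
      unfolding chi_star_def \<gamma> by (auto simp: fun_eq_iff)
    then have "smat_vec A (\<lambda>\<gamma>. chi_star \<gamma> \<xi>) \<beta> = A \<beta> \<gamma>"
      unfolding smat_vec_eq_mult[of _ _ _ undefined]
      by (subst smat_mult_eq_sum[of "{\<gamma>}"]) auto
    then show ?thesis
      using \<gamma> by auto
  next
    case False
    then have "chi_star \<delta> \<xi> = 0" for \<delta>
      unfolding chi_star_def by auto
    then show ?thesis
      unfolding smat_vec_def if_not_P[OF False] by (simp only: mult_zero_right Sum_any.neutral)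
  qed
  show ?thesis
  proof (cases "\<exists>\<gamma>. \<xi> = (\<lambda>a. - int (\<gamma> a) - 1)")
    case True
    let ?\<gamma> = "\<lambda>a. nat (- \<xi> a - 1)"
    have "smat_vec \<omega> (\<lambda>\<beta>. second_kind S H \<beta> \<xi>) \<alpha> = smat_mult \<omega> U \<alpha> ?\<gamma>"
      unfolding second_kind_def col if_P[OF True] by (simp only: smat_vec_def smat_mult_def)
    then show ?thesis
      unfolding second_kind_def col if_P[OF True] connector_mult_U .
  next
    case False
    then show ?thesis
      unfolding second_kind_def col if_not_P[OF False]
      by (simp only: smat_vec_def mult_zero_right Sum_any.neutral)
  qed
qed

lemma diag_mult_transpose:
  assumes D: "block_diag_invertible D" and A: "block_lower_unitri A"
  shows "mdeg \<beta> < mdeg \<alpha> \<Longrightarrow> smat_mult D (smat_transpose A) \<alpha> \<beta> = 0"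
    and "mdeg \<beta> = mdeg \<alpha> \<Longrightarrow> smat_mult D (smat_transpose A) \<alpha> \<beta> = D \<alpha> \<beta>"
proof -
  have eq: "smat_mult D (smat_transpose A) \<alpha> \<beta> = (\<Sum>\<gamma>\<in>deg_set (mdeg \<alpha>). D \<alpha> \<gamma> * A \<beta> \<gamma>)"
    unfolding smat_transpose_def
    by (rule smat_mult_eq_sum) (auto simp: block_diag_invertible_off_diag[OF D])
  show "smat_mult D (smat_transpose A) \<alpha> \<beta> = 0" if "mdeg \<beta> < mdeg \<alpha>"
    unfolding eq using that bandedD[OF block_lower_unitri_banded[OF A], of \<beta>]
    by (intro sum.neutral) auto
  show "smat_mult D (smat_transpose A) \<alpha> \<beta> = D \<alpha> \<beta>" if "mdeg \<beta> = mdeg \<alpha>"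
  proof -
    have "(\<Sum>\<gamma>\<in>deg_set (mdeg \<alpha>). D \<alpha> \<gamma> * A \<beta> \<gamma>) = (\<Sum>\<gamma>\<in>deg_set (mdeg \<alpha>). if \<gamma> = \<beta> then D \<alpha> \<gamma> else 0)"
      using that by (intro sum.cong) (auto simp: block_lower_unitri_diag[OF A] smat_one_def)
    then show ?thesis
      unfolding eq using that by (simp add: sum.delta)
  qed
qed

text \<open>
  \<open>\<omega> U = TU\<close> with \<open>U\<close> and \<open>TU\<close> block upper triangular, and the diagonal blocks of \<open>U\<close> are those
  of \<open>H\<close>, hence invertible.
\<close>

lemma connector_lower_eq_0: "mdeg \<gamma> < mdeg \<alpha> \<Longrightarrow> \<omega> \<alpha> \<gamma> = 0"
proof (induction "mdeg \<gamma>" arbitrary: \<gamma> rule: less_induct)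
  case less
  show ?case
  proof (rule block_diag_invertible_left_kernel[OF diag(1)])
    fix \<beta> :: "'d multiindex" assume \<beta>: "mdeg \<beta> = mdeg \<gamma>"
    \<comment> \<open>Lower degrees vanish by the induction hypothesis and higher ones because
      \<open>U\<close> is block upper triangular, so one block of the row remains, multiplied by a
      block of \<open>H\<close>.\<close>
    have "\<omega> \<alpha> \<delta> * U \<delta> \<beta> = 0" if "\<delta> \<notin> deg_set (mdeg \<gamma>)" for \<delta>
    proof (cases "mdeg \<delta> < mdeg \<gamma>")
      case True
      then show ?thesis using less by auto
    next
      case False
      then have "U \<delta> \<beta> = 0"
        using that \<beta> by (intro diag_mult_transpose(1)[OF diag(1) R_unitri(1)]) auto
      then show ?thesis by simp
    qed
    then have "smat_mult \<omega> U \<alpha> \<beta> = (\<Sum>\<delta>\<in>deg_set (mdeg \<gamma>). \<omega> \<alpha> \<delta> * U \<delta> \<beta>)"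
      by (intro smat_mult_eq_sum) simp_all
    also have "\<dots> = (\<Sum>\<delta>\<in>deg_set (mdeg \<gamma>). \<omega> \<alpha> \<delta> * H \<delta> \<beta>)"
      using \<beta> by (intro sum.cong refl) (simp add: diag_mult_transpose(2)[OF diag(1) R_unitri(1)])
    also have "smat_mult \<omega> U \<alpha> \<beta> = 0"
      unfolding connector_mult_U
      using \<beta> less.prems by (intro diag_mult_transpose(1)[OF diag(2) R_unitri(2)]) auto
    finally show "(\<Sum>\<delta>\<in>deg_set (mdeg \<gamma>). \<omega> \<alpha> \<delta> * H \<delta> \<beta>) = 0"
      by simp
  qed simp
qed

text \<open>Only \<open>M\<close> can raise the degree, and by at most \<open>m\<close>. Gaining
  \<open>m\<close> degrees forces \<open>TS\<close> and \<open>R\<close> to act through their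
  identity diagonal blocks.\<close>

lemma connector_leading:
  assumes "mdeg \<beta> = mdeg \<alpha> + m"
  shows "\<omega> \<alpha> \<beta> = M \<alpha> \<beta>"
proof -
  have "TS \<alpha> \<gamma> * smat_mult M R \<gamma> \<beta> = 0" if "\<gamma> \<noteq> \<alpha>" for \<gamma>
  proof (cases "mdeg \<gamma> < mdeg \<alpha>")
    case True
    then show ?thesis using assms bandedD[OF banded_MR, of \<gamma> \<beta>] by simp
  next
    case False
    then show ?thesis
      using that bandedD[OF banded_facts(2), of \<alpha> \<gamma>] block_lower_unitri_diag[OF unitri(2), of \<alpha> \<gamma>]
      by (cases "mdeg \<gamma> = mdeg \<alpha>") (auto simp: smat_one_def)
  qed
  then have "\<omega> \<alpha> \<beta> = smat_mult M R \<alpha> \<beta>"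
    unfolding connector_def
    by (subst smat_mult_eq_sum[of "{\<alpha>}"]) (auto simp: block_lower_unitri_diag[OF unitri(2)] smat_one_def)
  moreover have "M \<alpha> \<gamma> * R \<gamma> \<beta> = 0" if "\<gamma> \<noteq> \<beta>" for \<gamma>
  proof (cases "mdeg \<gamma> < mdeg \<beta>")
    case True
    then show ?thesis using bandedD[OF banded_facts(3), of \<gamma> \<beta>] by simp
  next
    case False
    then show ?thesis
      using that assms bandedD[OF M, of \<alpha> \<gamma>] block_lower_unitri_diag[OF R_unitri(1), of \<gamma> \<beta>]
      by (cases "mdeg \<gamma> = mdeg \<beta>") (auto simp: smat_one_def)
  qed
  then have "smat_mult M R \<alpha> \<beta> = M \<alpha> \<beta>"
    by (subst smat_mult_eq_sum[of "{\<beta>}"]) (auto simp: block_lower_unitri_diag[OF R_unitri(1)] smat_one_def)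
  ultimately show ?thesis by simp
qed

end

section \<open>Quasi-determinants and the Christoffel formulas\<close>

text \<open>One elimination serves both formulas: \<open>F\<close>, \<open>G\<close> stand for
  \<open>P\<close>, \<open>Q TP\<close> at a point or for \<open>C\<close>, \<open>TC\<close> at an
  exponent. The last block of block row \<open>k\<close> of \<open>w\<close> is known, and vanishing
  at the nodes expresses the others through it.\<close>

lemma quasi_det_elimination:
  fixes w V :: "'d::{finite,linorder} smat" and P :: "'d multiindex \<Rightarrow> 'd point \<Rightarrow> real"
    and F G :: "'d multiindex \<Rightarrow> 'z \<Rightarrow> real" and k m :: nat and p :: "nat \<Rightarrow> nat \<Rightarrow> 'd point"
  defines "N \<equiv> \<lambda>l. card (deg_set l :: 'd multiindex set)"
  defines "\<Sigma> \<equiv> \<lambda>i l. sample_matrix P (N (k + i)) (p i) l"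
  assumes "m \<ge> 1"
    and supp: "\<And>\<alpha> \<beta>. mdeg \<alpha> = k \<Longrightarrow> mdeg \<beta> \<notin> {k..k + m} \<Longrightarrow> w \<alpha> \<beta> = 0"
    and top: "\<And>\<alpha> \<beta>. mdeg \<alpha> = k \<Longrightarrow> mdeg \<beta> = k + m \<Longrightarrow> w \<alpha> \<beta> = V \<alpha> \<beta>"
    and nodes: "\<And>i j \<alpha>. i < m \<Longrightarrow> j < N (k + i) \<Longrightarrow> mdeg \<alpha> = k \<Longrightarrow> smat_vec w (\<lambda>\<beta>. P \<beta> (p i j)) \<alpha> = 0"
    and rel: "\<And>\<alpha>. mdeg \<alpha> = k \<Longrightarrow> smat_vec w (\<lambda>\<beta>. F \<beta> z) \<alpha> = G \<alpha> z"
    and det: "Determinant.det (block_mat (map (\<lambda>l. map (\<lambda>i. \<Sigma> i l) [0..<m]) [k..<k + m])) \<noteq> 0"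
  defines "\<Theta> \<equiv> quasi_det (map (\<lambda>l. map (\<lambda>i. \<Sigma> i l) [0..<m] @ [col_block F l z]) [k..<k + m + 1])"
  shows "col_block G k z = block V k (k + m) * \<Theta>" and "\<Theta> \<in> carrier_mat (N (k + m)) 1"
proof -
  define idx :: "'d multiindex list" where "idx = concat (map deg_list [k..<k + m])"
  define pts where "pts = concat (map (\<lambda>i. map (p i) [0..<N (k + i)]) [0..<m])"
  let ?d = "deg_list k :: 'd multiindex list" and ?t = "deg_list (k + m) :: 'd multiindex list"
  have ne: "[0..<m] \<noteq> []" "[k..<k + m] \<noteq> []"
    using \<open>m \<ge> 1\<close> by auto
  have \<Sigma>: "\<Sigma> = (\<lambda>i l. list_mat P (deg_list l) (map (p i) [0..<N (k + i)]))"
    by (simp add: \<Sigma>_def sample_matrix_list_mat)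

  \<comment> \<open>Node set \<open>i\<close>, counted from 0, has as many points as there are
    multi-indices of degree \<open>k + i\<close>, so the sample matrix is square.\<close>
  have "length idx = (\<Sum>l\<leftarrow>[k..<k + m]. N l)"
    by (simp add: idx_def length_concat comp_def N_def)
  also have "[k..<k + m] = map (\<lambda>i. k + i) [0..<m]"
    by (simp add: map_add_upt add.commute[of k])
  also have "(\<Sum>l\<leftarrow>\<dots>. N l) = length pts"
    by (simp add: pts_def length_concat comp_def)
  finally have len: "length pts = length idx" ..

  have A: "block_mat (map (\<lambda>l. map (\<lambda>i. \<Sigma> i l) [0..<m]) [k..<k + m]) = list_mat P idx pts"
    unfolding \<Sigma> idx_def pts_def by (rule block_mat_list_mat[OF ne(2,1)])
  have B: "block_mat (map (\<lambda>l. [list_mat F (deg_list l) [z]]) [k..<k + m]) = list_mat F idx [z]"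
    using block_mat_list_mat[OF ne(2), of "[z]" F deg_list "\<lambda>z. [z]"]
    by (simp add: idx_def)
  have C: "block_mat [map (\<lambda>i. \<Sigma> i (k + m)) [0..<m]] = list_mat P ?t pts"
    unfolding \<Sigma> pts_def
    using block_mat_list_mat[OF _ ne(1), of "[k + m]" P deg_list "\<lambda>i. map (p i) [0..<N (k + i)]"]
    by simp
  have quasi: "\<Theta> =
      list_mat F ?t [z] - list_mat P ?t pts * the (mat_inverse (list_mat P idx pts)) * list_mat F idx [z]"
    by (simp add: \<Theta>_def quasi_det_def Let_def comp_def A B C col_block_list_mat)
  show "\<Theta> \<in> carrier_mat (N (k + m)) 1"
    by (rule carrier_matI) (simp_all add: quasi N_def)

  have "distinct (concat (map deg_list [k..<k + m]) :: 'd multiindex list)"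
    by (induction m) auto
  then have "distinct idx"
    by (simp only: idx_def)
  \<comment> \<open>The support of block row \<open>k\<close> lies in degrees \<open>k\<close> to
    \<open>k + m\<close>; splitting off the top degree separates the unknown blocks from the known
    one. The label type is general because \<open>f\<close> is later both \<open>F\<close> and
    \<open>P\<close>.\<close>
  have split: "list_mat w ?d idx * list_mat f idx zs + list_mat w ?d ?t * list_mat f ?t zs =
      list_mat (\<lambda>\<alpha> z. smat_vec w (\<lambda>\<beta>. f \<beta> z) \<alpha>) ?d zs" for f :: "'d multiindex \<Rightarrow> 'y \<Rightarrow> real" and zs
  proof -
    have "(\<Sum>\<beta>\<in>set idx. w \<alpha> \<beta> * f \<beta> z) + (\<Sum>\<beta>\<in>set ?t. w \<alpha> \<beta> * f \<beta> z) = smat_vec w (\<lambda>\<beta>. f \<beta> z) \<alpha>"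
      if "mdeg \<alpha> = k" for \<alpha> z
    proof -
      have "smat_vec w (\<lambda>\<beta>. f \<beta> z) \<alpha> = (\<Sum>\<beta>\<in>set idx \<union> set ?t. w \<alpha> \<beta> * f \<beta> z)"
        unfolding smat_vec_eq_mult[of _ _ _ undefined]
      proof (rule smat_mult_eq_sum)
        fix \<beta> assume "\<beta> \<notin> set idx \<union> set ?t"
        then have "mdeg \<beta> \<notin> {k..k + m}"
          by (auto simp: idx_def)
        then show "w \<alpha> \<beta> * f \<beta> z = 0"
          using supp that by simp
      qed simp
      also have "\<dots> = (\<Sum>\<beta>\<in>set idx. w \<alpha> \<beta> * f \<beta> z) + (\<Sum>\<beta>\<in>set ?t. w \<alpha> \<beta> * f \<beta> z)"
        by (rule sum.union_disjoint) (auto simp: idx_def)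
      finally show ?thesis ..
    qed
    moreover have "mdeg (?d ! i) = k" if "i < length ?d" for i
      using nth_mem[OF that] by simp
    ultimately show ?thesis
      unfolding list_mat_mult_distinct[OF \<open>distinct idx\<close>] list_mat_mult_distinct[OF distinct_deg_list]
      by (intro eq_matI) simp_all
  qed
  have "col_block G k z = list_mat w ?d idx * list_mat F idx [z] + list_mat w ?d ?t * list_mat F ?t [z]"
    unfolding split col_block_list_mat list_mat_eq_iff using rel by simp
  also have "\<dots> = list_mat w ?d ?t * (list_mat F ?t [z]
      - list_mat P ?t pts * the (mat_inverse (list_mat P idx pts)) * list_mat F idx [z])"
  proof (rule mat_schur_elim)
    show "Determinant.det (list_mat P idx pts) \<noteq> 0"
      using det unfolding A .
    \<comment> \<open>At the nodes the split sum is zero, which is the annihilation hypothesis of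
      \<open>mat_schur_elim\<close>.\<close>
    have "list_mat w ?d idx * list_mat P idx pts + list_mat w ?d ?t * list_mat P ?t pts
        = list_mat (\<lambda>_ _. 0) ?d pts"
      unfolding split list_mat_eq_iff using nodes by (auto simp: pts_def)
    then show "list_mat w ?d idx * list_mat P idx pts + list_mat w ?d ?t * list_mat P ?t pts
        = 0\<^sub>m (length ?d) (length idx)"
      unfolding zero_list_mat[symmetric] len .
  qed (auto simp flip: len)
  also have "list_mat w ?d ?t = block V k (k + m)"
    unfolding block_list_mat list_mat_eq_iff using top by simp
  finally show "col_block G k z = block V k (k + m) * \<Theta>"
    unfolding quasi .
qed

section \<open>The Christoffel formulas for polynomials and second kind functions\<close>

theorem theorem3p5p2:
  fixes \<Omega> :: "'d::{finite,linorder} point set"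
    and \<mu> :: "'d rmeasure"
    and m k :: nat
    and n :: "nat \<Rightarrow> 'd point" and q :: "nat \<Rightarrow> real"
    and p :: "nat \<Rightarrow> nat \<Rightarrow> 'd point"
    and S H TS TH :: "'d smat"
  defines "Q \<equiv> \<lambda>x. \<Prod>i<m. (inner (n i) x - q i)"
    and "N \<equiv> \<lambda>l. card (deg_set l :: 'd multiindex set)"
    and "P \<equiv> orth_poly S" and "C \<equiv> second_kind S H"
    and "TP \<equiv> orth_poly TS" and "TC \<equiv> second_kind TS TH"
  defines "\<Sigma> \<equiv> \<lambda>i l. sample_matrix P (N (k + i)) (p i) l"
  assumes "borel_on \<Omega> \<mu>" and "finite_moments \<mu>"
    and "block_cholesky (moment_matrix \<mu>) S H"
    and "block_cholesky (moment_matrix (darboux_comp m n q \<mu>)) TS TH"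
    and "m \<ge> 1"
    and nodes: "(\<Union>i<m. p i ` {..<N (k + i)}) \<subseteq> (\<Union>i<m. {x. inner (n i) x = q i})"
    and poised: "Determinant.det (block_mat (map (\<lambda>l. map (\<lambda>i. \<Sigma> i l) [0..<m]) [k..<k + m])) \<noteq> 0"
  shows "(\<forall>x. Q x \<noteq> 0 \<longrightarrow>
            col_block TP k x =
              (1 / Q x) \<cdot>\<^sub>m block (shift_prod m n) k (k + m) *
              quasi_det (map (\<lambda>l. map (\<lambda>i. \<Sigma> i l) [0..<m] @ [col_block P l x]) [k..<k + m + 1])) \<and>
         (\<forall>\<xi>. col_block TC k \<xi> =
              block (shift_prod m n) k (k + m) *
              quasi_det (map (\<lambda>l. map (\<lambda>i. \<Sigma> i l) [0..<m] @ [col_block C l \<xi>]) [k..<k + m + 1]))"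
proof -
  define M where "M = linear_prod_smat n q [0..<m]"
  have banded_M: "banded m M"
    unfolding M_def using banded_linear_prod_smat[of "[0..<m]" n q] by simp
  have moments: "moment_matrix (darboux_comp m n q \<mu>) = smat_mult M (moment_matrix \<mu>)"
    unfolding darboux_comp_def M_def using moment_matrix_foldr_darboux[OF \<open>finite_moments \<mu>\<close>] by blast
  interpret connected_factorizations M S H TS TH "moment_matrix \<mu>" m
    by unfold_locales (fact banded_M \<open>block_cholesky (moment_matrix \<mu>) S H\<close>
      \<open>block_cholesky (moment_matrix (darboux_comp m n q \<mu>)) TS TH\<close>[unfolded moments])+

  have "(\<Prod>i\<leftarrow>[0..<m]. inner (n i) x - q i) = Q x" for x
    unfolding Q_def using prod.distinct_set_conv_list[of "[0..<m]" "\<lambda>i. inner (n i) x - q i"]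
    by (simp only: distinct_upt set_upt atLeast0LessThan simp_thms)
  then have M_monom: "smat_mult M (\<lambda>\<beta> _. mv_monom \<beta> x) = (\<lambda>\<alpha> _. Q x * mv_monom \<alpha> x)" for x
    unfolding M_def linear_prod_smat_monom by simp
  have P: "smat_vec \<omega> (\<lambda>\<beta>. P \<beta> x) \<alpha> = Q x * TP \<alpha> x" for \<alpha> x
  proof -
    have "smat_vec \<omega> (\<lambda>\<beta>. P \<beta> x) \<alpha> = smat_vec (smat_mult TS M) (\<lambda>\<beta>. mv_monom \<beta> x) \<alpha>"
      unfolding P_def by (rule smat_vec_orth_poly)
    also have "\<dots> = Q x * TP \<alpha> x"
      unfolding TP_def orth_poly_def smat_vec_eq_mult[of _ _ _ undefined]
      by (simp add: smat_mult_assoc[OF banded_facts(2) M] M_monom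
          banded_mult_eq[OF banded_facts(2) le_refl] sum_distrib_left mult.left_commute)
    finally show ?thesis .
  qed
  \<comment> \<open>Degrees below \<open>k\<close> are excluded by block upper triangularity of
    \<open>\<omega>\<close>, those above \<open>k + m\<close> by its band.\<close>
  have supp: "\<omega> \<alpha> \<beta> = 0" if "mdeg \<alpha> = k" "mdeg \<beta> \<notin> {k..k + m}" for \<alpha> \<beta>
    using that connector_lower_eq_0[of \<beta> \<alpha>] bandedD[OF banded_connector, of \<alpha> \<beta>] by auto
  have top: "\<omega> \<alpha> \<beta> = shift_prod m n \<alpha> \<beta>" if "mdeg \<alpha> = k" "mdeg \<beta> = k + m" for \<alpha> \<beta>
    using that connector_leading[of \<beta> \<alpha>] linear_prod_smat_leading[of \<beta> \<alpha> "[0..<m]" n q]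
    by (simp add: M_def shift_prod_def)
  have nodes': "smat_vec \<omega> (\<lambda>\<beta>. P \<beta> (p i j)) \<alpha> = 0" if "i < m" "j < N (k + i)" "mdeg \<alpha> = k" for i j \<alpha>
  proof -
    have "p i j \<in> (\<Union>i<m. p i ` {..<N (k + i)})"
      using that by blast
    \<comment> \<open>A node of set \<open>i\<close> may lie on any of the hyperplanes; one
      vanishing factor, of index \<open>i'\<close>, suffices.\<close>
    then obtain i' where "i' < m" "inner (n i') (p i j) = q i'"
      using subsetD[OF nodes] by blast
    then have "Q (p i j) = 0"
      unfolding Q_def by (intro prod_zero) auto
    then show ?thesis
      by (simp add: P)
  qed
  have elim:
    "col_block G k z = block (shift_prod m n) k (k + m) *
       quasi_det (map (\<lambda>l. map (\<lambda>i. \<Sigma> i l) [0..<m] @ [col_block F l z]) [k..<k + m + 1])"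
    "quasi_det (map (\<lambda>l. map (\<lambda>i. \<Sigma> i l) [0..<m] @ [col_block F l z]) [k..<k + m + 1])
       \<in> carrier_mat (N (k + m)) 1"
    if "\<And>\<alpha>. mdeg \<alpha> = k \<Longrightarrow> smat_vec \<omega> (\<lambda>\<beta>. F \<beta> z) \<alpha> = G \<alpha> z"
    for F G :: "'d multiindex \<Rightarrow> 'z \<Rightarrow> real" and z
    unfolding \<Sigma>_def N_def
    by - (rule quasi_det_elimination[where w = \<omega> and V = "shift_prod m n" and P = P and p = p
          and F = F and G = G and z = z, OF \<open>m \<ge> 1\<close> supp top nodes'[unfolded N_def] that
          poised[unfolded \<Sigma>_def N_def]]; assumption)+
  show ?thesis
  proof (intro conjI allI impI)
    fix x assume "Q x \<noteq> 0"
    \<comment> \<open>The connector maps \<open>P\<close> to \<open>Q TP\<close>, so the elimination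
      is applied to the latter and \<open>Q x\<close> is divided out.\<close>
    then have "col_block TP k x = (1 / Q x) \<cdot>\<^sub>m col_block (\<lambda>\<alpha> x. Q x * TP \<alpha> x) k x"
      by (intro eq_matI) (auto simp: col_block_def)
    also have "col_block (\<lambda>\<alpha> x. Q x * TP \<alpha> x) k x = block (shift_prod m n) k (k + m) *
        quasi_det (map (\<lambda>l. map (\<lambda>i. \<Sigma> i l) [0..<m] @ [col_block P l x]) [k..<k + m + 1])"
      (is "_ = ?V * ?\<Theta>")
      by (rule elim(1)) (rule P)
    also have "(1 / Q x) \<cdot>\<^sub>m (?V * ?\<Theta>) = (1 / Q x) \<cdot>\<^sub>m ?V * ?\<Theta>"
    proof (rule mult_smult_assoc_mat[symmetric])
      show "?V \<in> carrier_mat (N k) (N (k + m))"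
        by (simp add: block_def N_def)
      show "?\<Theta> \<in> carrier_mat (N (k + m)) 1"
        by (rule elim(2)) (rule P)
    qed
    finally show "col_block TP k x = (1 / Q x) \<cdot>\<^sub>m block (shift_prod m n) k (k + m) *
        quasi_det (map (\<lambda>l. map (\<lambda>i. \<Sigma> i l) [0..<m] @ [col_block P l x]) [k..<k + m + 1])" .
  next
    show "col_block TC k \<xi> = block (shift_prod m n) k (k + m) *
        quasi_det (map (\<lambda>l. map (\<lambda>i. \<Sigma> i l) [0..<m] @ [col_block C l \<xi>]) [k..<k + m + 1])" for \<xi>
      by (rule elim(1)) (simp only: C_def TC_def smat_vec_second_kind)
  qed
qed

end
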